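(* Let $\Lambda$ be a finite-dimensional associative algebra over a field $k$ and let $M\in\operatorname{mod}\Lambda$. Then $M$ is a minimal extending module for some torsion class over $\Lambda$ if and only if $M$ is a brick.
   Context: $\operatorname{mod}\Lambda$ is the category of finite-dimensional (left) $\Lambda$-modules. A torsion class is a class of modules in $\operatorname{mod}\Lambda$ closed under factors (quotients), isomorphisms and extensions. A module $M$ is a brick if its endomorphism ring is a division ring. A module $M$ is a minimal extending module for a torsion class $\mathcal{T}$ if: (P1) every proper factor of $M$ is in $\mathcal{T}$; (P2) if $0\to M\to X\to T\to 0$ is a non-split exact sequence with $T\in\mathcal{T}$, then $X\in\mathcal{T}$; (P3) $\operatorname{Hom}(\mathcal{T},M)=0$.
   Formalization: The module M is assumed nonzero; for M = 0 the claim fails as stated, since the zero module satisfies (P1)–(P3) for every torsion class but its endomorphism ring is the zero ring, so it is not a brick. *)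

theory Defs
  imports "HOL-Algebra.RingHom" "Jordan_Normal_Form.Missing_VectorSpace"
begin

section \<open>Algebras and their finite-dimensional modules\<close>

text \<open>
  The locale \<open>algebra\<close> of HOL-Algebra is restricted to commutative algebras, and \<open>module\<close> to
  modules over commutative rings, so both notions are introduced here for the general case. The
  record of type \<open>module\<close> and the set \<open>module_hom\<close> of module homomorphisms are reused; the
  multiplicative part of the record is irrelevant for a module.
\<close>

locale fin_dim_algebra = vectorspace K A + ring A for K and A (structure) +
  assumes smult_mult_left:
      "\<lbrakk>c \<in> carrier K; a \<in> carrier A; b \<in> carrier A\<rbrakk> \<Longrightarrow> (c \<odot> a) \<otimes> b = c \<odot> (a \<otimes> b)"
    and smult_mult_right:
      "\<lbrakk>c \<in> carrier K; a \<in> carrier A; b \<in> carrier A\<rbrakk> \<Longrightarrow> a \<otimes> (c \<odot> b) = c \<odot> (a \<otimes> b)"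
    and finite_dimensional: "fin_dim"

locale left_module = R?: ring R + M?: abelian_group M
  for R :: "('a, 's) ring_scheme" (structure) and M :: "('a, 'x, 't) module_scheme" (structure) +
  assumes smult_closed:
      "\<lbrakk>a \<in> carrier R; x \<in> carrier M\<rbrakk> \<Longrightarrow> a \<odot>\<^bsub>M\<^esub> x \<in> carrier M"
    and smult_l_distr:
      "\<lbrakk>a \<in> carrier R; b \<in> carrier R; x \<in> carrier M\<rbrakk> \<Longrightarrow> (a \<oplus> b) \<odot>\<^bsub>M\<^esub> x = a \<odot>\<^bsub>M\<^esub> x \<oplus>\<^bsub>M\<^esub> b \<odot>\<^bsub>M\<^esub> x"
    and smult_r_distr:
      "\<lbrakk>a \<in> carrier R; x \<in> carrier M; y \<in> carrier M\<rbrakk> \<Longrightarrow> a \<odot>\<^bsub>M\<^esub> (x \<oplus>\<^bsub>M\<^esub> y) = a \<odot>\<^bsub>M\<^esub> x \<oplus>\<^bsub>M\<^esub> a \<odot>\<^bsub>M\<^esub> y"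
    and smult_assoc1:
      "\<lbrakk>a \<in> carrier R; b \<in> carrier R; x \<in> carrier M\<rbrakk> \<Longrightarrow> (a \<otimes> b) \<odot>\<^bsub>M\<^esub> x = a \<odot>\<^bsub>M\<^esub> (b \<odot>\<^bsub>M\<^esub> x)"
    and smult_one:
      "x \<in> carrier M \<Longrightarrow> \<one> \<odot>\<^bsub>M\<^esub> x = x"

text \<open>The \<open>K\<close>-vector space underlying an \<open>A\<close>-module: \<open>c\<close> acts as \<open>c \<odot> 1\<close>.\<close>

definition restrict_scalars ::
  "('k, 'a, 's) module_scheme \<Rightarrow> ('a, 'x, 't) module_scheme \<Rightarrow> ('k, 'x) module"
  where "restrict_scalars A X =
    \<lparr>carrier = carrier X, mult = mult X, one = one X, zero = zero X, add = add X,
     smult = (\<lambda>c x. (c \<odot>\<^bsub>A\<^esub> \<one>\<^bsub>A\<^esub>) \<odot>\<^bsub>X\<^esub> x)\<rparr>"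

lemma vectorspace_restrict_scalars:
  assumes "fin_dim_algebra K A" and "left_module A X"
  shows "vectorspace K (restrict_scalars A X)"
proof -
  interpret A: fin_dim_algebra K A by fact
  interpret X: left_module A X by fact
  have "vectorspace K A" ..
  then have K: "field K" and "cring K"
    by (auto simp: vectorspace_def module_def)
  have "abelian_group (restrict_scalars A X)"
    by (rule abelian_groupI)
      (auto simp: restrict_scalars_def X.M.a_ac intro: X.M.l_neg)
  moreover have "c \<otimes>\<^bsub>K\<^esub> d \<odot>\<^bsub>A\<^esub> \<one>\<^bsub>A\<^esub> = (c \<odot>\<^bsub>A\<^esub> \<one>\<^bsub>A\<^esub>) \<otimes>\<^bsub>A\<^esub> (d \<odot>\<^bsub>A\<^esub> \<one>\<^bsub>A\<^esub>)"
    if "c \<in> carrier K" "d \<in> carrier K" for c d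
    using that by (simp add: A.smult_mult_left A.module.smult_assoc1)
  ultimately have "module K (restrict_scalars A X)"
    by (intro moduleI)
      (auto simp: restrict_scalars_def X.smult_closed X.smult_l_distr X.smult_r_distr
        X.smult_assoc1 X.smult_one A.module.smult_l_distr \<open>cring K\<close>)
  with K show ?thesis
    by (simp add: vectorspace_def)
qed

definition fin_dim_module ::
  "('k, 'r) ring_scheme \<Rightarrow> ('k, 'a, 's) module_scheme \<Rightarrow> ('a, 'x, 't) module_scheme \<Rightarrow> bool"
  where "fin_dim_module K A X \<longleftrightarrow>
    left_module A X \<and> vectorspace.fin_dim K (restrict_scalars A X)"

definition surj_hom ::
  "('a, 's) ring_scheme \<Rightarrow> ('a, 'x, 't) module_scheme \<Rightarrow> ('a, 'y, 'u) module_scheme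
    \<Rightarrow> ('x \<Rightarrow> 'y) set"
  where "surj_hom A X Y = {f \<in> module_hom A X Y. f ` carrier X = carrier Y}"

definition module_iso ::
  "('a, 's) ring_scheme \<Rightarrow> ('a, 'x, 't) module_scheme \<Rightarrow> ('a, 'y, 'u) module_scheme
    \<Rightarrow> ('x \<Rightarrow> 'y) set"
  where "module_iso A X Y = {f \<in> module_hom A X Y. bij_betw f (carrier X) (carrier Y)}"

definition short_exact ::
  "('a, 's) ring_scheme \<Rightarrow> ('a, 'x, 't) module_scheme \<Rightarrow> ('x \<Rightarrow> 'y) \<Rightarrow> ('a, 'y, 'u) module_scheme
    \<Rightarrow> ('y \<Rightarrow> 'z) \<Rightarrow> ('a, 'z, 'v) module_scheme \<Rightarrow> bool"
  where "short_exact A X f Y g Z \<longleftrightarrow>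
    f \<in> module_hom A X Y \<and> inj_on f (carrier X) \<and>
    g \<in> surj_hom A Y Z \<and>
    f ` carrier X = a_kernel Y Z g"

definition splits ::
  "('a, 's) ring_scheme \<Rightarrow> ('a, 'x, 't) module_scheme \<Rightarrow> ('x \<Rightarrow> 'y) \<Rightarrow> ('a, 'y, 'u) module_scheme
    \<Rightarrow> bool"
  where "splits A X f Y \<longleftrightarrow> (\<exists>r \<in> module_hom A Y X. \<forall>x \<in> carrier X. r (f x) = x)"

section \<open>Torsion classes\<close>

text \<open>
  The class \<open>mod A\<close> is represented by the modules whose elements are lists of scalars. As every
  finite-dimensional vector space over \<open>K\<close> is isomorphic to some \<open>K\<^sup>n\<close>, every finite-dimensional
  module of any type is isomorphic to one of these, so classes of modules closed under isomorphism
  correspond to isomorphism-closed sets of modules of this kind.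
\<close>

definition mod_cat ::
  "('k, 'r) ring_scheme \<Rightarrow> ('k, 'a, 's) module_scheme \<Rightarrow> ('a, 'k list) module set"
  where "mod_cat K A = {X. fin_dim_module K A X}"

definition torsion_class ::
  "('k, 'r) ring_scheme \<Rightarrow> ('k, 'a, 's) module_scheme \<Rightarrow> ('a, 'k list) module set \<Rightarrow> bool"
  where "torsion_class K A T \<longleftrightarrow>
    T \<subseteq> mod_cat K A \<and>
    (\<forall>X \<in> T. \<forall>Y \<in> mod_cat K A. surj_hom A X Y \<noteq> {} \<longrightarrow> Y \<in> T) \<and>
    (\<forall>X \<in> T. \<forall>Y \<in> mod_cat K A. module_iso A X Y \<noteq> {} \<longrightarrow> Y \<in> T) \<and>
    (\<forall>X \<in> T. \<forall>Z \<in> T. \<forall>Y \<in> mod_cat K A. \<forall>f g. short_exact A X f Y g Z \<longrightarrow> Y \<in> T)"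

section \<open>Minimal extending modules and bricks\<close>

text \<open>
  A factor of \<open>M\<close> is the target of a surjective homomorphism from \<open>M\<close>; it is proper if that
  homomorphism has a nonzero kernel. Note that the zero module is minimal extending for every
  torsion class, as it has no proper factors and every sequence starting with it splits; but its
  endomorphism ring is zero, so it is not a brick.
\<close>

definition minimal_extending ::
  "('k, 'r) ring_scheme \<Rightarrow> ('k, 'a, 's) module_scheme \<Rightarrow> ('a, 'k list) module set
    \<Rightarrow> ('a, 'm, 't) module_scheme \<Rightarrow> bool"
  where "minimal_extending K A T M \<longleftrightarrow>
    (\<forall>X \<in> mod_cat K A. \<forall>p \<in> surj_hom A M X. a_kernel M X p \<noteq> {\<zero>\<^bsub>M\<^esub>} \<longrightarrow> X \<in> T) \<and>
    (\<forall>Z \<in> T. \<forall>X \<in> mod_cat K A. \<forall>f g.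
      short_exact A M f X g Z \<and> \<not> splits A M f X \<longrightarrow> X \<in> T) \<and>
    (\<forall>X \<in> T. \<forall>h \<in> module_hom A X M. \<forall>x \<in> carrier X. h x = \<zero>\<^bsub>M\<^esub>)"

locale skew_field = ring R for R (structure) +
  assumes one_not_zero: "\<one> \<noteq> \<zero>"
    and skew_field_Units: "Units R = carrier R - {\<zero>}"

text \<open>
  Homomorphisms are only determined on the carrier; requiring them to be extensional makes the
  elements of the endomorphism ring unique.
\<close>

definition End_ring :: "('a, 's) ring_scheme \<Rightarrow> ('a, 'm, 't) module_scheme \<Rightarrow> ('m \<Rightarrow> 'm) ring"
  where "End_ring A M =
    \<lparr>carrier = module_hom A M M \<inter> extensional (carrier M),
     mult = compose (carrier M),
     one = (\<lambda>x \<in> carrier M. x),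
     zero = (\<lambda>x \<in> carrier M. \<zero>\<^bsub>M\<^esub>),
     add = (\<lambda>f g. \<lambda>x \<in> carrier M. f x \<oplus>\<^bsub>M\<^esub> g x)\<rparr>"

definition brick :: "('a, 's) ring_scheme \<Rightarrow> ('a, 'm, 't) module_scheme \<Rightarrow> bool"
  where "brick A M \<longleftrightarrow> skew_field (End_ring A M)"

end

theory Submission
  imports Defs
begin

text \<open>
  If \<open>M\<close> is a brick, the torsion class \<open>{X. Hom(X, M) = 0}\<close> works. Let \<open>h : X \<rightarrow> M\<close> be nonzero.
  If \<open>p : M \<rightarrow> X\<close> is onto, then \<open>h \<circ> p\<close> is a nonzero endomorphism, so it is invertible and \<open>p\<close> is
  injective. If \<open>f : M \<rightarrow> X\<close> starts a short exact sequence ending in the torsion class, then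
  \<open>h \<circ> f\<close> is nonzero, as \<open>h\<close> would otherwise factor through the cokernel of \<open>f\<close>; so it is
  invertible and \<open>f\<close> splits.
  Conversely, if an endomorphism of a minimal extending module has a nonzero kernel, then its image
  is in the torsion class by (P1), so that the inclusion of the image is zero by (P3); hence every
  nonzero endomorphism is injective and, by dimension, bijective.
\<close>

section \<open>Module homomorphisms and factorization through a surjection\<close>

lemma (in left_module) smult_zero:
  assumes "a \<in> carrier R"
  shows "a \<odot>\<^bsub>M\<^esub> \<zero>\<^bsub>M\<^esub> = \<zero>\<^bsub>M\<^esub>"
  using smult_r_distr[OF assms M.zero_closed M.zero_closed] assms by (simp add: smult_closed)

lemma module_hom_zero:
  assumes "left_module A X" "left_module A Y" "f \<in> module_hom A X Y"
  shows "f \<zero>\<^bsub>X\<^esub> = \<zero>\<^bsub>Y\<^esub>"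
proof -
  interpret X: left_module A X by fact
  interpret Y: left_module A Y by fact
  have "f \<zero>\<^bsub>X\<^esub> \<oplus>\<^bsub>Y\<^esub> f \<zero>\<^bsub>X\<^esub> = f \<zero>\<^bsub>X\<^esub>"
    using module_hom_add[OF assms(3) X.M.zero_closed X.M.zero_closed] by simp
  moreover have "f \<zero>\<^bsub>X\<^esub> \<in> carrier Y"
    using module_hom_closed[OF assms(3)] by auto
  ultimately show ?thesis by simp
qed

lemma module_hom_compose:
  assumes "f \<in> module_hom A X Y" "g \<in> module_hom A Y Z"
  shows "g \<circ> f \<in> module_hom A X Z"
  using assms by (auto simp: module_hom_def Pi_iff)

lemma module_hom_restrict:
  assumes "left_module A X" "f \<in> module_hom A X Y"
  shows "restrict f (carrier X) \<in> module_hom A X Y"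
proof -
  interpret X: left_module A X by fact
  show ?thesis using assms(2) by (auto simp: module_hom_def X.smult_closed)
qed

text \<open>The kernel condition makes \<open>h\<close> constant on the fibres of \<open>g\<close>,
  so \<open>k y\<close> can be read off from any preimage of \<open>y\<close>. With \<open>g\<close>
  the cokernel map of a short exact sequence, this is the universal property of the
  cokernel.\<close>

lemma module_hom_factor:
  assumes X: "left_module A X" and Y: "left_module A Y" and Z: "left_module A Z"
    and g: "g \<in> surj_hom A X Y" and h: "h \<in> module_hom A X Z"
    and ker: "\<And>x. \<lbrakk>x \<in> carrier X; g x = \<zero>\<^bsub>Y\<^esub>\<rbrakk> \<Longrightarrow> h x = \<zero>\<^bsub>Z\<^esub>"
  shows "\<exists>k \<in> module_hom A Y Z. \<forall>x \<in> carrier X. k (g x) = h x"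
proof -
  interpret X: left_module A X by fact
  interpret Y: left_module A Y by fact
  interpret Z: left_module A Z by fact
  have g_hom: "g \<in> module_hom A X Y" and surj: "g ` carrier X = carrier Y"
    using g by (auto simp: surj_hom_def)
  have hC: "h x \<in> carrier Z" if "x \<in> carrier X" for x
    using module_hom_closed[OF h] that by auto
  have gC: "g x \<in> carrier Y" if "x \<in> carrier X" for x
    using module_hom_closed[OF g_hom] that by auto
  have eq: "h x = h y" if x: "x \<in> carrier X" and y: "y \<in> carrier X" and xy: "g x = g y" for x y
  proof -
    \<comment> \<open>Equality on fibres reduces to the kernel condition at the difference of
      \<open>x\<close> and \<open>y\<close>. Comparing with the sum of \<open>y\<close> and its own
      negative leaves a common summand to cancel, so no rule for images of negatives is called
      for.\<close>
    have y': "\<ominus>\<^bsub>X\<^esub> y \<in> carrier X" using y by simp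
    have "g (x \<oplus>\<^bsub>X\<^esub> \<ominus>\<^bsub>X\<^esub> y) = g (y \<oplus>\<^bsub>X\<^esub> \<ominus>\<^bsub>X\<^esub> y)"
      using module_hom_add[OF g_hom x y'] module_hom_add[OF g_hom y y'] xy by simp
    also have "\<dots> = \<zero>\<^bsub>Y\<^esub>"
      using y by (simp add: X.M.r_neg module_hom_zero[OF X Y g_hom])
    finally have "h (x \<oplus>\<^bsub>X\<^esub> \<ominus>\<^bsub>X\<^esub> y) = \<zero>\<^bsub>Z\<^esub>" using ker x y by simp
    then have "h x \<oplus>\<^bsub>Z\<^esub> h (\<ominus>\<^bsub>X\<^esub> y) = h y \<oplus>\<^bsub>Z\<^esub> h (\<ominus>\<^bsub>X\<^esub> y)"
      using module_hom_add[OF h x y'] module_hom_add[OF h y y'] y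
      by (simp add: X.M.r_neg module_hom_zero[OF X Z h])
    then show ?thesis using hC x y y' by simp
  qed
  \<comment> \<open>A section of \<open>g\<close> as a map of sets, in general not a homomorphism.
    Only \<open>h \<circ> s\<close> is one, because \<open>h\<close> does not see the choice of
    preimage.\<close>
  define s where "s = inv_into (carrier X) g"
  have s: "s y \<in> carrier X" "g (s y) = y" if "y \<in> carrier Y" for y
    using that unfolding s_def surj[symmetric] by (auto intro: inv_into_into f_inv_into_f)
  have "h \<circ> s \<in> module_hom A Y Z"
  proof -
    \<comment> \<open>The chosen preimage of the sum and the sum of the chosen preimages have the
      same image under \<open>g\<close>, so \<open>eq\<close> identifies their values under
      \<open>h\<close>. Scalar multiples are treated in the same way.\<close>
    have "h (s (y \<oplus>\<^bsub>Y\<^esub> z)) = h (s y) \<oplus>\<^bsub>Z\<^esub> h (s z)" if "y \<in> carrier Y" "z \<in> carrier Y" for y z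
      using that s module_hom_add[OF h, symmetric]
      by (auto intro!: eq simp: module_hom_add[OF g_hom])
    moreover have "h (s (a \<odot>\<^bsub>Y\<^esub> y)) = a \<odot>\<^bsub>Z\<^esub> h (s y)" if "a \<in> carrier A" "y \<in> carrier Y" for a y
      using that s module_hom_smult[OF h, symmetric]
      by (auto intro!: eq simp: module_hom_smult[OF g_hom] X.smult_closed Y.smult_closed)
    ultimately show ?thesis
      using s hC by (auto simp: module_hom_def)
  qed
  moreover have "(h \<circ> s) (g x) = h x" if "x \<in> carrier X" for x
    using that s gC by (auto intro: eq)
  ultimately show ?thesis by blast
qed

text \<open>By exactness \<open>h\<close> vanishes on the kernel of \<open>g\<close>, so it factors
  through \<open>Z\<close>, where every map to \<open>M\<close> is zero. This serves both closure
  under extensions and (P2).\<close>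

lemma short_exact_hom_zero:
  assumes Y: "left_module A Y" and Z: "left_module A Z" and M: "left_module A M"
    and ex: "short_exact A X f Y g Z" and h: "h \<in> module_hom A Y M"
    and hf: "\<And>x. x \<in> carrier X \<Longrightarrow> h (f x) = \<zero>\<^bsub>M\<^esub>"
    and hom_Z: "\<And>k z. \<lbrakk>k \<in> module_hom A Z M; z \<in> carrier Z\<rbrakk> \<Longrightarrow> k z = \<zero>\<^bsub>M\<^esub>"
    and y: "y \<in> carrier Y"
  shows "h y = \<zero>\<^bsub>M\<^esub>"
proof -
  have g: "g \<in> surj_hom A Y Z" and ker: "f ` carrier X = a_kernel Y Z g"
    using ex by (auto simp: short_exact_def)
  have "\<exists>x \<in> carrier X. u = f x" if "u \<in> carrier Y" "g u = \<zero>\<^bsub>Z\<^esub>" for u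
    using that ker by (auto simp: a_kernel_def' set_eq_iff image_iff)
  then have "h u = \<zero>\<^bsub>M\<^esub>" if "u \<in> carrier Y" "g u = \<zero>\<^bsub>Z\<^esub>" for u
    using that hf by metis
  then obtain k where k: "k \<in> module_hom A Z M" "\<forall>y \<in> carrier Y. k (g y) = h y"
    using module_hom_factor[OF Y Z M g h] by blast
  have "g y \<in> carrier Z" using g y by (auto simp: surj_hom_def)
  then show ?thesis using hom_Z[OF k(1)] k(2) y by metis
qed

section \<open>Images of modules and finite dimension\<close>

text \<open>Every element of \<open>Y\<close> has the form \<open>p u\<close>, so each axiom is
  inherited from \<open>X\<close>. As \<open>Y\<close> is not yet known to be a group, that
  \<open>p\<close> preserves zero cannot be derived by cancellation and is assumed.\<close>

lemma left_module_image:
  assumes "left_module A X" and p: "p \<in> surj_hom A X Y" and zero: "\<zero>\<^bsub>Y\<^esub> = p \<zero>\<^bsub>X\<^esub>"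
  shows "left_module A Y"
proof -
  interpret X: left_module A X by fact
  have p_hom: "p \<in> module_hom A X Y" and surj: "carrier Y = p ` carrier X"
    using p by (auto simp: surj_hom_def)
  note p_simps = module_hom_add[OF p_hom, symmetric] module_hom_smult[OF p_hom, symmetric]
  have "abelian_group Y"
  proof (rule abelian_groupI)
    fix x assume "x \<in> carrier Y"
    then obtain u where u: "u \<in> carrier X" "x = p u" using surj by auto
    then show "\<exists>y \<in> carrier Y. y \<oplus>\<^bsub>Y\<^esub> x = \<zero>\<^bsub>Y\<^esub>"
      using surj by (auto simp: zero p_simps X.M.l_neg intro!: bexI[of _ "\<ominus>\<^bsub>X\<^esub> u"])
  qed (auto simp: surj zero p_simps X.M.a_ac)
  moreover have "ring A" ..
  ultimately show ?thesis
    by (auto simp: left_module_def left_module_axioms_def surj p_simps X.smult_closed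
      X.smult_l_distr X.smult_r_distr X.smult_assoc1 X.smult_one)
qed

lemma linear_map_restrict_scalars:
  assumes A: "fin_dim_algebra K A" and X: "left_module A X" and Y: "left_module A Y"
    and f: "f \<in> module_hom A X Y"
  shows "linear_map K (restrict_scalars A X) (restrict_scalars A Y) f"
proof -
  interpret A: fin_dim_algebra K A by fact
  have "f \<in> module_hom K (restrict_scalars A X) (restrict_scalars A Y)"
    using f by (auto simp: module_hom_def restrict_scalars_def)
  then show ?thesis
    using vectorspace_restrict_scalars[OF A X] vectorspace_restrict_scalars[OF A Y]
    by (simp add: linear_map_def mod_hom_def mod_hom_axioms_def vectorspace_def)
qed

lemma fin_dim_module_image:
  assumes A: "fin_dim_algebra K A" and X: "fin_dim_module K A X"
    and p: "p \<in> surj_hom A X Y" and zero: "\<zero>\<^bsub>Y\<^esub> = p \<zero>\<^bsub>X\<^esub>"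
  shows "fin_dim_module K A Y"
proof -
  have Xm: "left_module A X" using X by (simp add: fin_dim_module_def)
  have Ym: "left_module A Y" using left_module_image[OF Xm p zero] .
  have "linear_map K (restrict_scalars A X) (restrict_scalars A Y) p"
    using linear_map_restrict_scalars[OF A Xm Ym] p by (simp add: surj_hom_def)
  then have "vectorspace.fin_dim K (restrict_scalars A Y)"
    by (rule linear_map.surj_fin_dim)
      (use X p in \<open>auto simp: fin_dim_module_def surj_hom_def restrict_scalars_def\<close>)
  with Ym show ?thesis by (simp add: fin_dim_module_def)
qed

text \<open>A vector is coded by the list of coefficients of one chosen combination of a finite
  generating set; the list determines the combination and hence the vector. This moves modules of
  any type to the type of lists of scalars.\<close>

lemma (in vectorspace) fin_dim_inj_list:
  assumes "fin_dim"
  shows "\<exists>\<phi> :: 'c \<Rightarrow> 'a list. inj_on \<phi> (carrier V)"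
proof -
  obtain B where B: "finite B" "B \<subseteq> carrier V" "gen_set B"
    using assms by (auto simp: fin_dim_def)
  obtain bs where bs: "set bs = B" using B(1) finite_list by blast
  have "\<exists>c. c \<in> B \<rightarrow> carrier K \<and> lincomb c B = v" if "v \<in> carrier V" for v
    using that B finite_in_span[OF B(1,2)] by auto
  then obtain c where c: "\<And>v. v \<in> carrier V \<Longrightarrow> c v \<in> B \<rightarrow> carrier K \<and> lincomb (c v) B = v"
    by metis
  have "inj_on (\<lambda>v. map (c v) bs) (carrier V)"
  proof (rule inj_onI)
    fix v w assume v: "v \<in> carrier V" and w: "w \<in> carrier V" and "map (c v) bs = map (c w) bs"
    then have "\<And>b. b \<in> B \<Longrightarrow> c v b = c w b" using bs by auto
    then have "lincomb (c v) B = lincomb (c w) B"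
      using lincomb_cong[OF refl B(2)] c[OF w] by blast
    then show "v = w" using c v w by simp
  qed
  then show ?thesis by blast
qed

text \<open>An injective map sends a basis to an independent set of the same size, which by equality
  of dimensions is a basis of the target.\<close>

lemma (in linear_map) inj_fin_dim_imp_surj:
  assumes fd: "V.fin_dim" "W.fin_dim" and dim: "V.dim = W.dim" and inj: "inj_on T (carrier V)"
  shows "T ` carrier V = carrier W"
proof -
  obtain B where B: "finite B" "V.basis B" using V.finite_basis_exists[OF fd(1)] by blast
  then have BV: "B \<subseteq> carrier V" and li: "V.module.lin_indpt B" by (auto simp: V.basis_def)
  have TB: "finite (T ` B)" "T ` B \<subseteq> carrier W" using B(1) BV by auto
  have card: "card (T ` B) = W.dim"
    using V.dim_basis[OF B] dim inj_on_subset[OF inj BV] by (simp add: card_image)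
  have "W.module.lin_indpt (T ` B)"
  proof (rule W.module.finite_lin_indpt2[OF TB])
    fix a assume a: "a \<in> T ` B \<rightarrow> carrier K" and 0: "W.module.lincomb a (T ` B) = \<zero>\<^bsub>W\<^esub>"
    have aT: "a \<circ> T \<in> B \<rightarrow> carrier K" using a by auto
    have "T (V.module.lincomb (a \<circ> T) B) = T \<zero>\<^bsub>V\<^esub>"
      using lincomb_linear_image[OF inj BV a B(1)] 0 by simp
    then have "V.module.lincomb (a \<circ> T) B = \<zero>\<^bsub>V\<^esub>"
      using inj_onD[OF inj] V.module.lincomb_closed[OF BV aT] by blast
    then show "\<forall>w \<in> T ` B. a w = \<zero>\<^bsub>K\<^esub>"
      using V.not_lindepD[OF li B(1) subset_refl aT] by auto
  qed
  then have "W.basis (T ` B)"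
    using W.dim_li_is_basis[OF fd(2) TB] card by simp
  then have "W.module.span (T ` B) = carrier W" by (simp add: W.basis_def)
  moreover have "W.module.span (T ` B) \<subseteq> imT"
    using W.module.span_is_subset[of "T ` B" imT] im_is_submodule BV by (auto simp: im_def)
  moreover have "imT \<subseteq> carrier W" by (auto simp: im_def)
  ultimately show ?thesis by (auto simp: im_def)
qed

lemma module_endo_inj_imp_surj:
  assumes A: "fin_dim_algebra K A" and X: "fin_dim_module K A X"
    and f: "f \<in> module_hom A X X" and inj: "inj_on f (carrier X)"
  shows "f ` carrier X = carrier X"
proof -
  have Xm: "left_module A X" using X by (simp add: fin_dim_module_def)
  show ?thesis
    using linear_map.inj_fin_dim_imp_surj[OF linear_map_restrict_scalars[OF A Xm Xm f]] X inj
    by (simp add: fin_dim_module_def restrict_scalars_def)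
qed

text \<open>The image factorization of \<open>f\<close>, with the image replaced by an isomorphic
  copy on lists of scalars. The copy is what allows (P1) and (P3), which speak of members of
  \<open>mod_cat K A\<close>, to be applied to the image.\<close>

lemma image_in_mod_cat:
  fixes K :: "('k, 'r) ring_scheme" and A :: "('k, 'a, 's) module_scheme"
    and X :: "('a, 'x, 't) module_scheme" and Y :: "('a, 'y, 'u) module_scheme"
  assumes A: "fin_dim_algebra K A" and X: "fin_dim_module K A X" and Y: "fin_dim_module K A Y"
    and f: "f \<in> module_hom A X Y"
  shows "\<exists>I \<in> mod_cat K A. \<exists>p \<in> surj_hom A X I. \<exists>j \<in> module_hom A I Y.
    inj_on j (carrier I) \<and> (\<forall>x \<in> carrier X. j (p x) = f x)"
proof -
  have Xm: "left_module A X" and Ym: "left_module A Y"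
    using X Y by (auto simp: fin_dim_module_def)
  interpret X: left_module A X by fact
  obtain \<phi> :: "'y \<Rightarrow> 'k list" where "inj_on \<phi> (carrier (restrict_scalars A Y))"
    using vectorspace.fin_dim_inj_list[OF vectorspace_restrict_scalars[OF A Ym]] Y
    by (auto simp: fin_dim_module_def)
  then have \<phi>: "inj_on \<phi> (carrier Y)" by (simp add: restrict_scalars_def)
  define \<psi> where "\<psi> = inv_into (carrier Y) \<phi>"
  have \<psi>: "\<psi> (\<phi> y) = y" if "y \<in> carrier Y" for y
    using that \<phi> by (simp add: \<psi>_def)
  have fC: "f x \<in> carrier Y" if "x \<in> carrier X" for x
    using module_hom_closed[OF f] that by auto
  \<comment> \<open>The structure of \<open>Y\<close> on the image of \<open>f\<close>, transported
    along \<open>\<phi>\<close>. The zero is written as the value of \<open>\<phi> \<circ> f\<close>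
    at zero, the form in which images inherit the module axioms; \<open>mult\<close> and
    \<open>one\<close> carry no meaning for a module.\<close>
  define I :: "('a, 'k list) module" where "I =
    \<lparr>carrier = \<phi> ` f ` carrier X, mult = undefined, one = undefined,
     zero = \<phi> (f \<zero>\<^bsub>X\<^esub>), add = (\<lambda>u v. \<phi> (\<psi> u \<oplus>\<^bsub>Y\<^esub> \<psi> v)), smult = (\<lambda>a u. \<phi> (a \<odot>\<^bsub>Y\<^esub> \<psi> u))\<rparr>"
  have p: "\<phi> \<circ> f \<in> surj_hom A X I"
    by (auto simp: surj_hom_def module_hom_def I_def \<psi> fC image_comp
      module_hom_add[OF f] module_hom_smult[OF f])
  then have "I \<in> mod_cat K A"
    using fin_dim_module_image[OF A X p] by (simp add: mod_cat_def I_def)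
  moreover have "\<psi> \<in> module_hom A I Y"
    by (auto simp: module_hom_def I_def \<psi> fC
      module_hom_add[OF f, symmetric] module_hom_smult[OF f, symmetric] X.smult_closed)
  moreover have "inj_on \<psi> (carrier I)"
    by (auto simp: inj_on_def I_def \<psi> fC)
  moreover have "\<forall>x \<in> carrier X. \<psi> ((\<phi> \<circ> f) x) = f x"
    by (simp add: \<psi> fC)
  ultimately show ?thesis using p by blast
qed

section \<open>Endomorphism rings and bricks\<close>

lemma ring_End_ring:
  assumes "left_module A M"
  shows "ring (End_ring A M)"
proof (rule ringI)
  interpret M: left_module A M by fact
  have uminus: "(\<lambda>x \<in> carrier M. \<ominus>\<^bsub>M\<^esub> f x) \<in> module_hom A M M" if f: "f \<in> module_hom A M M" for f
  proof -
    have fC: "f x \<in> carrier M" if "x \<in> carrier M" for x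
      using module_hom_closed[OF f] that by auto
    have "\<ominus>\<^bsub>M\<^esub> (a \<odot>\<^bsub>M\<^esub> x) = a \<odot>\<^bsub>M\<^esub> (\<ominus>\<^bsub>M\<^esub> x)" if a: "a \<in> carrier A" and x: "x \<in> carrier M" for a x
    proof (rule M.M.minus_equality)
      show "a \<odot>\<^bsub>M\<^esub> (\<ominus>\<^bsub>M\<^esub> x) \<oplus>\<^bsub>M\<^esub> a \<odot>\<^bsub>M\<^esub> x = \<zero>\<^bsub>M\<^esub>"
        using a x by (simp add: M.smult_r_distr[symmetric] M.M.l_neg M.smult_zero)
    qed (use a x in \<open>auto simp: M.smult_closed\<close>)
    then show ?thesis
      using f fC by (auto simp: module_hom_def M.M.minus_add M.smult_closed)
  qed
  have zero: "(\<lambda>x \<in> carrier M. \<zero>\<^bsub>M\<^esub>) \<in> module_hom A M M"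
    by (auto simp: module_hom_def M.smult_closed M.smult_zero)
  show "abelian_group (End_ring A M)"
  proof (rule abelian_groupI)
    fix f assume "f \<in> carrier (End_ring A M)"
    then show "\<exists>g \<in> carrier (End_ring A M). g \<oplus>\<^bsub>End_ring A M\<^esub> f = \<zero>\<^bsub>End_ring A M\<^esub>"
      using uminus module_hom_closed[of f A M M]
      by (intro bexI[of _ "\<lambda>x \<in> carrier M. \<ominus>\<^bsub>M\<^esub> f x"])
        (auto simp: End_ring_def M.M.l_neg Pi_iff cong: restrict_cong)
  qed (use zero in \<open>auto simp: End_ring_def module_hom_def Pi_iff M.M.a_ac M.smult_closed
      M.smult_r_distr extensional_def fun_eq_iff\<close>)
  show "monoid (End_ring A M)"
    by (rule monoidI)
      (auto simp: End_ring_def module_hom_def Pi_iff M.smult_closed compose_def extensional_def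
        fun_eq_iff)
  have closed: "f x \<in> carrier M" if "f \<in> module_hom A M M" "x \<in> carrier M" for f x
    using module_hom_closed[OF that(1)] that(2) by auto
  fix f g h
  assume "f \<in> carrier (End_ring A M)" "g \<in> carrier (End_ring A M)" "h \<in> carrier (End_ring A M)"
  then have "f \<in> module_hom A M M" "g \<in> module_hom A M M" "h \<in> module_hom A M M"
    by (simp_all add: End_ring_def)
  then show "(f \<oplus>\<^bsub>End_ring A M\<^esub> g) \<otimes>\<^bsub>End_ring A M\<^esub> h =
      f \<otimes>\<^bsub>End_ring A M\<^esub> h \<oplus>\<^bsub>End_ring A M\<^esub> g \<otimes>\<^bsub>End_ring A M\<^esub> h"
    and "h \<otimes>\<^bsub>End_ring A M\<^esub> (f \<oplus>\<^bsub>End_ring A M\<^esub> g) =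
      h \<otimes>\<^bsub>End_ring A M\<^esub> f \<oplus>\<^bsub>End_ring A M\<^esub> h \<otimes>\<^bsub>End_ring A M\<^esub> g"
    by (auto simp: End_ring_def compose_def closed module_hom_add[of h A M M]
      intro!: restrict_ext)
qed

text \<open>The inverse of a bijective endomorphism is again an endomorphism, so each nonzero
  element of the ring is a unit. A nonzero element of \<open>M\<close> separates one from
  zero.\<close>

lemma brickI:
  assumes M: "left_module A M" and nonzero: "carrier M \<noteq> {\<zero>\<^bsub>M\<^esub>}"
    and bij: "\<And>f x. \<lbrakk>f \<in> module_hom A M M; x \<in> carrier M; f x \<noteq> \<zero>\<^bsub>M\<^esub>\<rbrakk>
      \<Longrightarrow> bij_betw f (carrier M) (carrier M)"
  shows "brick A M"
proof -
  interpret M: left_module A M by fact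
  let ?C = "carrier M" and ?E = "End_ring A M"
  obtain m where m: "m \<in> ?C" "m \<noteq> \<zero>\<^bsub>M\<^esub>" using nonzero M.M.zero_closed by blast
  \<comment> \<open>Extensionality reduces equality with the zero of the ring to vanishing on the
    carrier.\<close>
  have nz: "f \<noteq> \<zero>\<^bsub>?E\<^esub> \<longleftrightarrow> (\<exists>x \<in> ?C. f x \<noteq> \<zero>\<^bsub>M\<^esub>)" if "f \<in> carrier ?E" for f
    using that by (auto simp: End_ring_def extensional_def fun_eq_iff)
  have "f \<in> Units ?E" if f: "f \<in> carrier ?E" "f \<noteq> \<zero>\<^bsub>?E\<^esub>" for f
  proof -
    have f_hom: "f \<in> module_hom A M M" using f by (simp add: End_ring_def)
    have f_bij: "bij_betw f ?C ?C" using bij[OF f_hom] f nz by blast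
    define g where "g = restrict (inv_into ?C f) ?C"
    have g: "g x \<in> ?C" "f (g x) = x" "g (f x) = x" "f x \<in> ?C" if "x \<in> ?C" for x
      using that f_bij bij_betw_inv_into_right[OF f_bij]
        bij_betw_inv_into_left[OF f_bij] bij_betw_apply[OF bij_betw_inv_into[OF f_bij]]
      by (auto simp: g_def bij_betw_apply)
    have f_inj: "x = y" if "f x = f y" "x \<in> ?C" "y \<in> ?C" for x y
      using that g(3) by metis
    have "g \<in> module_hom A M M"
    proof -
      \<comment> \<open>Both sides are compared after applying \<open>f\<close>, which is injective
        and undoes \<open>g\<close>.\<close>
      have "g (x \<oplus>\<^bsub>M\<^esub> y) = g x \<oplus>\<^bsub>M\<^esub> g y" if "x \<in> ?C" "y \<in> ?C" for x y
        by (rule f_inj) (simp_all add: that g module_hom_add[OF f_hom])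
      moreover have "g (a \<odot>\<^bsub>M\<^esub> x) = a \<odot>\<^bsub>M\<^esub> g x" if "a \<in> carrier A" "x \<in> ?C" for a x
        by (rule f_inj) (simp_all add: that g M.smult_closed module_hom_smult[OF f_hom])
      ultimately show ?thesis by (auto simp: module_hom_def g)
    qed
    then have "g \<in> carrier ?E" by (simp add: End_ring_def g_def)
    moreover have "g \<otimes>\<^bsub>?E\<^esub> f = \<one>\<^bsub>?E\<^esub>" "f \<otimes>\<^bsub>?E\<^esub> g = \<one>\<^bsub>?E\<^esub>"
      by (auto simp: End_ring_def compose_def g cong: restrict_cong)
    ultimately show ?thesis using f by (auto simp: Units_def)
  qed
  moreover have "\<zero>\<^bsub>?E\<^esub> \<notin> Units ?E"
  proof
    assume "\<zero>\<^bsub>?E\<^esub> \<in> Units ?E"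
    then obtain g where g: "g \<in> module_hom A M M" "g \<otimes>\<^bsub>?E\<^esub> \<zero>\<^bsub>?E\<^esub> = \<one>\<^bsub>?E\<^esub>"
      by (auto simp: Units_def End_ring_def)
    \<comment> \<open>Both sides of the ring equation are evaluated at \<open>m\<close>: the product
      gives the value of \<open>g\<close> at zero, the identity gives \<open>m\<close>.\<close>
    have "g \<zero>\<^bsub>M\<^esub> = m"
      using fun_cong[OF g(2), of m] m by (simp add: End_ring_def compose_def)
    then show False using module_hom_zero[OF M M g(1)] m by simp
  qed
  moreover have "\<one>\<^bsub>?E\<^esub> \<noteq> \<zero>\<^bsub>?E\<^esub>"
    using m by (auto simp: End_ring_def fun_eq_iff)
  moreover have "Units ?E \<subseteq> carrier ?E" by (auto simp: Units_def)
  ultimately show ?thesis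
    using ring_End_ring[OF M] by (auto simp: brick_def skew_field_def skew_field_axioms_def)
qed

text \<open>Restricting \<open>f\<close> to the carrier gives a nonzero element of the endomorphism
  ring, hence a unit. The left inverse is the form in which invertibility enters below: it yields
  injectivity for (P1) and a retraction for (P2).\<close>

lemma brick_left_inverse:
  assumes M: "left_module A M" and "brick A M"
    and f: "f \<in> module_hom A M M" and x: "x \<in> carrier M" "f x \<noteq> \<zero>\<^bsub>M\<^esub>"
  shows "\<exists>g \<in> module_hom A M M. \<forall>y \<in> carrier M. g (f y) = y"
proof -
  let ?E = "End_ring A M" and ?f = "restrict f (carrier M)"
  have "?f \<noteq> \<zero>\<^bsub>?E\<^esub>"
    using x by (auto simp: End_ring_def dest: fun_cong[of _ _ x])
  moreover have "?f \<in> carrier ?E"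
    using module_hom_restrict[OF M f] by (simp add: End_ring_def)
  ultimately have "?f \<in> Units ?E"
    using \<open>brick A M\<close> by (simp add: brick_def skew_field_def skew_field_axioms_def)
  then obtain g where g: "g \<in> module_hom A M M" and "compose (carrier M) g ?f = (\<lambda>x \<in> carrier M. x)"
    by (auto simp: Units_def End_ring_def)
  then have "g (f y) = y" if "y \<in> carrier M" for y
    using that by (metis compose_eq restrict_apply')
  with g show ?thesis by blast
qed

section \<open>The torsion class of modules without nonzero maps to a brick\<close>

text \<open>A map from a factor of \<open>X\<close> to \<open>M\<close> is determined by its
  composite with the surjection from \<open>X\<close>, which is zero. For an extension, a map to
  \<open>M\<close> vanishes on the submodule and then factors through the quotient.\<close>

lemma torsion_class_hom_zero:
  assumes M: "left_module A M"
  shows "torsion_class K A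
    {X \<in> mod_cat K A. \<forall>h \<in> module_hom A X M. \<forall>x \<in> carrier X. h x = \<zero>\<^bsub>M\<^esub>}"
    (is "torsion_class K A ?T")
proof -
  have mod: "left_module A X" if "X \<in> mod_cat K A" for X
    using that by (simp add: mod_cat_def fin_dim_module_def)
  have quot: "Y \<in> ?T" if X: "X \<in> ?T" and Y: "Y \<in> mod_cat K A" and p: "p \<in> surj_hom A X Y" for X Y p
  proof -
    have "h y = \<zero>\<^bsub>M\<^esub>" if h: "h \<in> module_hom A Y M" and y: "y \<in> carrier Y" for h y
    proof -
      obtain x where x: "x \<in> carrier X" "y = p x" using p y by (auto simp: surj_hom_def)
      have "h \<circ> p \<in> module_hom A X M"
        using p h by (auto simp: surj_hom_def intro: module_hom_compose)
      then have "(h \<circ> p) x = \<zero>\<^bsub>M\<^esub>" using X x(1) by blast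
      with x show ?thesis by simp
    qed
    with Y show ?thesis by blast
  qed
  have iso: "Y \<in> ?T" if "X \<in> ?T" "Y \<in> mod_cat K A" "p \<in> module_iso A X Y" for X Y p
    using quot[OF that(1,2), of p] that(3)
    by (simp add: module_iso_def surj_hom_def bij_betw_def)
  have ext: "Y \<in> ?T"
    if X: "X \<in> ?T" and Z: "Z \<in> ?T" and Y: "Y \<in> mod_cat K A" and ex: "short_exact A X f Y g Z"
    for X Y Z f g
  proof -
    have f: "f \<in> module_hom A X Y" using ex by (simp add: short_exact_def)
    have "h y = \<zero>\<^bsub>M\<^esub>" if h: "h \<in> module_hom A Y M" and y: "y \<in> carrier Y" for h y
    proof (rule short_exact_hom_zero[OF _ _ M ex h _ _ y])
      show "h (f x) = \<zero>\<^bsub>M\<^esub>" if "x \<in> carrier X" for x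
        using X that module_hom_compose[OF f h] by fastforce
    qed (use Y Z mod in auto)
    with Y show ?thesis by blast
  qed
  show ?thesis
    unfolding torsion_class_def
  proof (intro conjI ballI allI impI)
    show "?T \<subseteq> mod_cat K A" by blast
    show "Y \<in> ?T" if "X \<in> ?T" "Y \<in> mod_cat K A" "surj_hom A X Y \<noteq> {}" for X Y
      using that(3) quot[OF that(1,2)] by (meson ex_in_conv)
    show "Y \<in> ?T" if "X \<in> ?T" "Y \<in> mod_cat K A" "module_iso A X Y \<noteq> {}" for X Y
      using that(3) iso[OF that(1,2)] by (meson ex_in_conv)
    show "Y \<in> ?T" if "X \<in> ?T" "Z \<in> ?T" "Y \<in> mod_cat K A" "short_exact A X f Y g Z" for X Z Y f g
      using ext[OF that] .
  qed
qed

lemma minimal_extending_hom_zero: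
  assumes M: "left_module A M" and brick: "brick A M"
  shows "minimal_extending K A
    {X \<in> mod_cat K A. \<forall>h \<in> module_hom A X M. \<forall>x \<in> carrier X. h x = \<zero>\<^bsub>M\<^esub>} M"
    (is "minimal_extending K A ?T M")
proof -
  have mod: "left_module A X" if "X \<in> mod_cat K A" for X
    using that by (simp add: mod_cat_def fin_dim_module_def)
  have "X \<in> ?T" if X: "X \<in> mod_cat K A" and p: "p \<in> surj_hom A M X"
    and ker: "a_kernel M X p \<noteq> {\<zero>\<^bsub>M\<^esub>}" for X p
  proof (rule ccontr)
    assume "X \<notin> ?T"
    then obtain h y where h: "h \<in> module_hom A X M" and y: "y \<in> carrier X" "h y \<noteq> \<zero>\<^bsub>M\<^esub>"
      using X by blast
    have p_hom: "p \<in> module_hom A M X" using p by (simp add: surj_hom_def)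
    obtain x where "x \<in> carrier M" "y = p x" using p y by (auto simp: surj_hom_def)
    then obtain g where g: "g \<in> module_hom A M M" "\<forall>y \<in> carrier M. g (h (p y)) = y"
      using brick_left_inverse[OF M brick module_hom_compose[OF p_hom h], of x] y by auto
    interpret M: left_module A M by fact
    \<comment> \<open>If \<open>p z\<close> is zero, then \<open>z = g (h (p z))\<close> is zero as
      well; so \<open>p\<close> has trivial kernel, against \<open>ker\<close>.\<close>
    have "z = \<zero>\<^bsub>M\<^esub>" if "z \<in> carrier M" "p z = \<zero>\<^bsub>X\<^esub>" for z
      using that g(2) module_hom_zero[OF mod[OF X] M h] module_hom_zero[OF M M g(1)] by force
    then show False
      using ker module_hom_zero[OF M mod[OF X] p_hom] by (auto simp: a_kernel_def')
  qed
  moreover have "X \<in> ?T" if Z: "Z \<in> ?T" and X: "X \<in> mod_cat K A"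
    and ex: "short_exact A M f X g Z" and nonsplit: "\<not> splits A M f X" for X Z f g
  proof (rule ccontr)
    have f: "f \<in> module_hom A M X" using ex by (simp add: short_exact_def)
    assume "X \<notin> ?T"
    then obtain h y where h: "h \<in> module_hom A X M" and y: "y \<in> carrier X" "h y \<noteq> \<zero>\<^bsub>M\<^esub>"
      using X by blast
    have hf: "h \<circ> f \<in> module_hom A M M" using module_hom_compose[OF f h] .
    have h_f: "h (f x) = \<zero>\<^bsub>M\<^esub>" if x: "x \<in> carrier M" for x
    proof (rule ccontr)
      assume "h (f x) \<noteq> \<zero>\<^bsub>M\<^esub>"
      then obtain k where k: "k \<in> module_hom A M M" "\<forall>y \<in> carrier M. k (h (f y)) = y"
        using brick_left_inverse[OF M brick hf x] by auto
      \<comment> \<open>The left inverse \<open>k\<close> of \<open>h \<circ> f\<close> makes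
        \<open>k \<circ> h\<close> a retraction of \<open>f\<close>.\<close>
      then have "splits A M f X"
        using module_hom_compose[OF h k(1)] unfolding splits_def by (intro bexI[of _ "k \<circ> h"]) auto
      with nonsplit show False ..
    qed
    have "h y = \<zero>\<^bsub>M\<^esub>"
      by (rule short_exact_hom_zero[OF _ _ M ex h h_f _ y(1)]) (use X Z mod in auto)
    with y show False by simp
  qed
  ultimately show ?thesis unfolding minimal_extending_def by blast
qed

section \<open>Minimal extending modules are bricks\<close>

lemma minimal_extending_imp_brick:
  assumes A: "fin_dim_algebra K A" and M: "fin_dim_module K A M"
    and nonzero: "carrier M \<noteq> {\<zero>\<^bsub>M\<^esub>}" and ext: "minimal_extending K A T M"
  shows "brick A M"
proof (rule brickI)
  show Mm: "left_module A M" using M by (simp add: fin_dim_module_def)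
  fix f x assume f: "f \<in> module_hom A M M" and x: "x \<in> carrier M" "f x \<noteq> \<zero>\<^bsub>M\<^esub>"
  obtain I p j where I: "I \<in> mod_cat K A" and p: "p \<in> surj_hom A M I"
    and j: "j \<in> module_hom A I M" "inj_on j (carrier I)" and jp: "\<forall>x \<in> carrier M. j (p x) = f x"
    using image_in_mod_cat[OF A M M f] by blast
  have Im: "left_module A I" using I by (simp add: mod_cat_def fin_dim_module_def)
  have p_hom: "p \<in> module_hom A M I" using p by (simp add: surj_hom_def)
  have "p x \<in> carrier I" using module_hom_closed[OF p_hom] x by auto
  \<comment> \<open>The inclusion \<open>j\<close> takes the nonzero value \<open>f x\<close> at
    \<open>p x\<close>, so (P3) keeps \<open>I\<close> out of \<open>T\<close>. By (P1) the factor
    \<open>I\<close> is then not proper, which is the triviality of the kernel of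
    \<open>p\<close>.\<close>
  then have "I \<notin> T" using ext j(1) jp x unfolding minimal_extending_def by metis
  then have ker: "a_kernel M I p = {\<zero>\<^bsub>M\<^esub>}"
    using ext I p unfolding minimal_extending_def by blast
  interpret M: left_module A M by (rule Mm)
  have "inj_on f (carrier M)"
  proof (rule inj_onI)
    fix y z assume y: "y \<in> carrier M" and z: "z \<in> carrier M" and "f y = f z"
    then have z': "\<ominus>\<^bsub>M\<^esub> z \<in> carrier M" by simp
    have "j (p y) = j (p z)" using \<open>f y = f z\<close> jp y z by simp
    then have "p y = p z"
      using inj_onD[OF j(2)] module_hom_closed[OF p_hom] y z by blast
    \<comment> \<open>The difference of \<open>y\<close> and \<open>z\<close> lies in the kernel of
      \<open>p\<close>; it is compared with the difference of \<open>z\<close> and itself so that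
      cancellation gives \<open>y = z\<close>.\<close>
    then have "p (y \<oplus>\<^bsub>M\<^esub> \<ominus>\<^bsub>M\<^esub> z) = p (z \<oplus>\<^bsub>M\<^esub> \<ominus>\<^bsub>M\<^esub> z)"
      using module_hom_add[OF p_hom y z'] module_hom_add[OF p_hom z z'] by simp
    then have "y \<oplus>\<^bsub>M\<^esub> \<ominus>\<^bsub>M\<^esub> z \<in> a_kernel M I p"
      using y z by (simp add: a_kernel_def' M.M.r_neg module_hom_zero[OF Mm Im p_hom])
    then have "y \<oplus>\<^bsub>M\<^esub> \<ominus>\<^bsub>M\<^esub> z = z \<oplus>\<^bsub>M\<^esub> \<ominus>\<^bsub>M\<^esub> z" using ker z by (simp add: M.M.r_neg)
    then show "y = z" using y z by simp
  qed
  then show "bij_betw f (carrier M) (carrier M)"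
    using module_endo_inj_imp_surj[OF A M f] by (simp add: bij_betw_def)
qed (rule nonzero)

theorem theorem1p0p3:
  fixes K :: "'k ring" and \<Lambda> :: "('k, 'a) module" and M :: "('a, 'm) module"
  assumes "fin_dim_algebra K \<Lambda>"
    and "fin_dim_module K \<Lambda> M"
    and "carrier M \<noteq> {\<zero>\<^bsub>M\<^esub>}"
  shows "(\<exists>T. torsion_class K \<Lambda> T \<and> minimal_extending K \<Lambda> T M) \<longleftrightarrow> brick \<Lambda> M"
proof
  assume "\<exists>T. torsion_class K \<Lambda> T \<and> minimal_extending K \<Lambda> T M"
  then show "brick \<Lambda> M" using minimal_extending_imp_brick[OF assms] by blast
next
  assume "brick \<Lambda> M"
  moreover have "left_module \<Lambda> M" using assms(2) by (simp add: fin_dim_module_def)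
  ultimately show "\<exists>T. torsion_class K \<Lambda> T \<and> minimal_extending K \<Lambda> T M"
    using torsion_class_hom_zero minimal_extending_hom_zero by blast
qed

end
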